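(* For every integer $k\ge 2$ there is a constant $\theta>\log_2 3$ such that $\pi(\vec T_k,\theta)=1$.
   Context: A partially directed $k$-graph ($k$-PDG) on a vertex set $V$ specifies for each $k$-subset $S\subseteq V$ exactly one of: no edge on $S$; an undirected edge on $S$; or a directed edge on $S$ directed toward a chosen vertex of $S$. For an $n$-vertex $k$-PDG $\vec H$, let $\alpha(\vec H)=e_u(\vec H)/\binom nk$ and $\beta(\vec H)=e_d(\vec H)/\binom nk$, where $e_u,e_d$ are the numbers of undirected and directed edges. A $k$-PDG $\vec F$ is a subgraph of $\vec H$ if a $k$-PDG isomorphic to $\vec F$ can be obtained from $\vec H$ by a sequence of deleting edges, deleting vertices, and forgetting the direction of edges; $\vec H$ is $\vec F$-free if $\vec F$ is not a subgraph of it. $\vec T_k$ is the $k$-PDG on vertex set $\{1,\dots,k+1\}$ with undirected edges $\{1,\dots,k\}$ and $\{2,\dots,k+1\}$ and a directed edge $\{1,\dots,k-1,k+1\}$ directed toward $k+1$. For a $k$-PDG $\vec F$ and real $\theta$, $\pi(\vec F,\theta)$ is the smallest real number such that every $n$-vertex $\vec F$-free $k$-PDG $\vec H$ satisfies $\alpha(\vec H)+\theta\beta(\vec H)\le \pi(\vec F,\theta)+o_{n\to\infty}(1)$. *)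

theory Defs
  imports Complex_Main
begin

datatype 'a pdg_status = No_Edge | Undirected | Directed 'a

record 'a pdg =
  verts :: "'a set"
  status :: "'a set \<Rightarrow> 'a pdg_status"

text \<open>The status function is total on sets; it carries information only on the \<open>k\<close>-subsets of the
  vertex set and is \<open>No_Edge\<close> on every other set.\<close>

definition is_pdg :: "nat \<Rightarrow> 'a pdg \<Rightarrow> bool" where
  "is_pdg k H \<longleftrightarrow> finite (verts H) \<and>
     (\<forall>S. status H S \<noteq> No_Edge \<longrightarrow> S \<subseteq> verts H \<and> card S = k) \<and>
     (\<forall>S v. status H S = Directed v \<longrightarrow> v \<in> S)"

definition undirected_edges :: "'a pdg \<Rightarrow> 'a set set" where
  "undirected_edges H = {S. status H S = Undirected}"

definition directed_edges :: "'a pdg \<Rightarrow> 'a set set" where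
  "directed_edges H = {S. \<exists>v. status H S = Directed v}"

definition pdg_alpha :: "nat \<Rightarrow> 'a pdg \<Rightarrow> real" where
  "pdg_alpha k H = real (card (undirected_edges H)) / real (card (verts H) choose k)"

definition pdg_beta :: "nat \<Rightarrow> 'a pdg \<Rightarrow> real" where
  "pdg_beta k H = real (card (directed_edges H)) / real (card (verts H) choose k)"

definition pdg_iso :: "'a pdg \<Rightarrow> 'b pdg \<Rightarrow> bool" where
  "pdg_iso F G \<longleftrightarrow> (\<exists>f. bij_betw f (verts F) (verts G) \<and>
     (\<forall>S. S \<subseteq> verts F \<longrightarrow> status G (f ` S) = map_pdg_status f (status F S)))"

inductive pdg_reduce :: "'a pdg \<Rightarrow> 'a pdg \<Rightarrow> bool" where
  delete_edge:
    "status H S \<noteq> No_Edge \<Longrightarrow> pdg_reduce H (H\<lparr>status := (status H)(S := No_Edge)\<rparr>)"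
| delete_vertex:
    "v \<in> verts H \<Longrightarrow>
     pdg_reduce H \<lparr>verts = verts H - {v}, status = (\<lambda>S. if v \<in> S then No_Edge else status H S)\<rparr>"
| forget_direction:
    "status H S = Directed v \<Longrightarrow> pdg_reduce H (H\<lparr>status := (status H)(S := Undirected)\<rparr>)"

definition pdg_subgraph :: "'a pdg \<Rightarrow> 'b pdg \<Rightarrow> bool" where
  "pdg_subgraph F H \<longleftrightarrow> (\<exists>G. pdg_reduce\<^sup>*\<^sup>* H G \<and> pdg_iso F G)"

definition pdg_free :: "'a pdg \<Rightarrow> 'b pdg \<Rightarrow> bool" where
  "pdg_free F H \<longleftrightarrow> \<not> pdg_subgraph F H"

definition pdg_T :: "nat \<Rightarrow> nat pdg" where
  "pdg_T k = \<lparr>verts = {1..k+1},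
     status = (\<lambda>S. if S = {1..k} \<or> S = {2..k+1} then Undirected
                   else if S = {1..k-1} \<union> {k+1} then Directed (k+1)
                   else No_Edge)\<rparr>"

text \<open>The error term may depend on the number of vertices only. Host graphs live on finite sets of
  naturals, which represent all finite \<open>k\<close>-PDGs up to isomorphism.\<close>

definition pdg_asymp_bound :: "nat \<Rightarrow> 'a pdg \<Rightarrow> real \<Rightarrow> real \<Rightarrow> bool" where
  "pdg_asymp_bound k F \<theta> x \<longleftrightarrow>
     (\<exists>err :: nat \<Rightarrow> real. err \<longlonglongrightarrow> 0 \<and>
        (\<forall>H :: nat pdg. is_pdg k H \<and> pdg_free F H \<longrightarrow>
           pdg_alpha k H + \<theta> * pdg_beta k H \<le> x + err (card (verts H))))"

definition pdg_pi :: "nat \<Rightarrow> 'a pdg \<Rightarrow> real \<Rightarrow> real" where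
  "pdg_pi k F \<theta> = (LEAST x. pdg_asymp_bound k F \<theta> x)"

lemma is_pdg_T: "k \<ge> 2 \<Longrightarrow> is_pdg k (pdg_T k)"
  by (auto simp: is_pdg_def pdg_T_def card_insert_if split: if_splits)

lemma is_pdg_reduce: "pdg_reduce H G \<Longrightarrow> is_pdg k H \<Longrightarrow> is_pdg k G"
  by (induction rule: pdg_reduce.induct) (auto simp: is_pdg_def split: if_splits)

end

theory Submission
  imports Defs
begin

text \<open>Complete undirected graphs give \<open>\<pi> \<ge> 1\<close> for every \<open>\<theta>\<close>. For the upper bound take
  \<open>\<theta> = 8/5\<close>, which exceeds \<open>log 2 3\<close> because \<open>3^5 < 2^8\<close>, and use a sum-of-squares certificate.
  Give every \<open>k\<close>-set \<open>S\<close> with a marked vertex \<open>u \<in> S\<close> a value \<open>g S u\<close>. Grouping by the common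
  \<open>(k-1)\<close>-set, the sum of \<open>g (W - {x}) y * g (W - {y}) x\<close> over all \<open>(k+1)\<close>-sets \<open>W\<close> and distinct
  \<open>x, y \<in> W\<close> is a sum of squares minus a lower-order diagonal. So it suffices that on each
  \<open>(k+1)\<close>-set the total weight of the \<open>k + 1\<close> potential edges plus a fixed positive multiple of this
  form is at most \<open>k + 1\<close>. If \<open>W\<close> spans no copy of \<open>T\<close>, then either every directed edge
  \<open>W - {x}\<close> has a head \<open>y\<close> for which \<open>W - {y}\<close> is a non-edge, or \<open>W\<close> spans exactly two edges, and the
  inequality is checked in both cases.\<close>

section \<open>Reductions of partially directed graphs and a criterion for containing a copy of
  \<open>pdg_T\<close>\<close>

lemma reduce_delete_vertices:
  assumes "finite A" "A \<subseteq> verts H"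
  shows "pdg_reduce\<^sup>*\<^sup>* H
    \<lparr>verts = verts H - A, status = (\<lambda>S. if S \<inter> A \<noteq> {} then No_Edge else status H S)\<rparr>"
  using assms
proof (induction A rule: finite_induct)
  case empty
  show ?case by (cases H) simp
next
  case (insert v A)
  let ?G = "\<lparr>verts = verts H - A, status = (\<lambda>S. if S \<inter> A \<noteq> {} then No_Edge else status H S)\<rparr>"
  have "v \<in> verts ?G" using insert by auto
  from pdg_reduce.delete_vertex[OF this]
  have "pdg_reduce ?G
    \<lparr>verts = verts ?G - {v}, status = (\<lambda>S. if v \<in> S then No_Edge else status ?G S)\<rparr>" .
  moreover have "\<lparr>verts = verts ?G - {v}, status = (\<lambda>S. if v \<in> S then No_Edge else status ?G S)\<rparr>
     = \<lparr>verts = verts H - insert v A,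
        status = (\<lambda>S. if S \<inter> insert v A \<noteq> {} then No_Edge else status H S)\<rparr>"
    by (auto simp: fun_eq_iff)
  ultimately have "pdg_reduce ?G \<lparr>verts = verts H - insert v A,
      status = (\<lambda>S. if S \<inter> insert v A \<noteq> {} then No_Edge else status H S)\<rparr>"
    by (simp only:)
  moreover have "pdg_reduce\<^sup>*\<^sup>* H ?G" using insert by blast
  ultimately show ?case by (rule rtranclp.rtrancl_into_rtrancl[rotated])
qed

text \<open>The order on the status of one set that deleting edges and forgetting directions
  generate. Directed statuses with different heads are incomparable, since no reduction redirects an
  edge.\<close>

definition status_weaker :: "'a pdg_status \<Rightarrow> 'a pdg_status \<Rightarrow> bool" where
  "status_weaker s t \<longleftrightarrow> s = t \<or> s = No_Edge \<or> s = Undirected \<and> t \<noteq> No_Edge"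

lemma reduce_weaken_edges:
  assumes "finite A" "\<And>S. status_weaker (f S) (status H S)" "\<And>S. S \<notin> A \<Longrightarrow> f S = status H S"
  shows "pdg_reduce\<^sup>*\<^sup>* H \<lparr>verts = verts H, status = f\<rparr>"
  using assms
proof (induction A arbitrary: f rule: finite_induct)
  case empty
  then have "f = status H" by auto
  then show ?case by (cases H) simp
next
  case (insert S A)
  \<comment> \<open>Restoring the old status at \<open>S\<close> lets the induction hypothesis
    handle the changes inside \<open>A\<close>; at most one reduction at \<open>S\<close> then
    remains.\<close>
  define f' where "f' = f(S := status H S)"
  let ?G = "\<lparr>verts = verts H, status = f'\<rparr>"
  have G: "pdg_reduce\<^sup>*\<^sup>* H ?G"
    using insert.prems by (intro insert.IH) (auto simp: f'_def status_weaker_def)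
  show ?case
  proof (cases "f S = status H S")
    case True
    then have "f' = f" by (auto simp: f'_def)
    then show ?thesis using G by simp
  next
    case False
    have "pdg_reduce ?G (?G\<lparr>status := (status ?G)(S := f S)\<rparr>)"
    proof (cases "f S")
      case No_Edge
      then have "status ?G S \<noteq> No_Edge" using False by (simp add: f'_def)
      from pdg_reduce.delete_edge[OF this] show ?thesis using No_Edge by simp
    next
      case Undirected
      then obtain v where "status H S = Directed v"
        using False insert.prems(1)[of S] by (cases "status H S") (auto simp: status_weaker_def)
      then have "status ?G S = Directed v" by (simp add: f'_def)
      from pdg_reduce.forget_direction[OF this] show ?thesis using Undirected by simp
    next
      case (Directed v)
      then show ?thesis using False insert.prems(1)[of S] by (simp add: status_weaker_def)
    qed
    moreover have "?G\<lparr>status := (status ?G)(S := f S)\<rparr> = \<lparr>verts = verts H, status = f\<rparr>"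
      by (simp add: f'_def)
    ultimately have "pdg_reduce ?G \<lparr>verts = verts H, status = f\<rparr>" by (simp only:)
    with G show ?thesis by (rule rtranclp.rtrancl_into_rtrancl)
  qed
qed

text \<open>First delete the vertices outside \<open>W\<close>, then weaken the surviving sets one
  at a time. This turns the search for a subgraph into a comparison of statuses on
  \<open>W\<close>.\<close>

lemma reduce_to_weaker:
  assumes H: "is_pdg k H" and W: "W \<subseteq> verts H"
    and weak: "\<And>S. S \<subseteq> W \<Longrightarrow> status_weaker (f S) (status H S)"
    and out: "\<And>S. \<not> S \<subseteq> W \<Longrightarrow> f S = No_Edge"
  shows "pdg_reduce\<^sup>*\<^sup>* H \<lparr>verts = W, status = f\<rparr>"
proof -
  let ?A = "verts H - W"
  let ?G = "\<lparr>verts = verts H - ?A, status = (\<lambda>S. if S \<inter> ?A \<noteq> {} then No_Edge else status H S)\<rparr>"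
  have fin: "finite (verts H)" using H by (simp add: is_pdg_def)
  have HG: "pdg_reduce\<^sup>*\<^sup>* H ?G" by (rule reduce_delete_vertices) (use fin in auto)
  have "pdg_reduce\<^sup>*\<^sup>* ?G \<lparr>verts = verts ?G, status = f\<rparr>"
  proof (rule reduce_weaken_edges)
    show "finite (Pow (verts H))" using fin by simp
  next
    fix S
    show "status_weaker (f S) (status ?G S)"
      using weak[of S] out[of S] by (cases "S \<subseteq> W") (auto simp: status_weaker_def)
  next
    \<comment> \<open>Only subsets of the finite vertex set can carry an edge, so finitely many
      single changes suffice.\<close>
    fix S assume S: "S \<notin> Pow (verts H)"
    then have "status H S = No_Edge" using H by (auto simp: is_pdg_def)
    moreover have "f S = No_Edge" using out[of S] S W by auto
    ultimately show "f S = status ?G S" by simp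
  qed
  with HG have "pdg_reduce\<^sup>*\<^sup>* H \<lparr>verts = verts ?G, status = f\<rparr>" by (rule rtranclp_trans)
  moreover have "verts ?G = W" using W by auto
  ultimately show ?thesis by (simp only:)
qed

text \<open>The three edges of \<open>pdg_T k\<close> are the complements of the vertices
  \<open>k+1\<close>, \<open>1\<close> and \<open>k\<close>, the last one directed toward
  \<open>k+1\<close>. With \<open>a\<close>, \<open>b\<close>, \<open>c\<close> in these roles, a
  copy is described by the three missing vertices alone, and the other \<open>k - 2\<close> vertices
  may be placed arbitrarily.\<close>

lemma pdg_T_subgraphI:
  assumes k: "k \<ge> 2" and H: "is_pdg k H" and W: "W \<subseteq> verts H" "card W = k + 1"
    and abc: "a \<in> W" "b \<in> W" "c \<in> W" "a \<noteq> b" "a \<noteq> c" "b \<noteq> c"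
    and st: "status H (W - {c}) = Directed a" "status H (W - {a}) \<noteq> No_Edge"
      "status H (W - {b}) \<noteq> No_Edge"
  shows "pdg_subgraph (pdg_T k) H"
proof -
  have finW: "finite W" using W by (metis Suc_eq_plus1 card.infinite nat.distinct(1))
  have "card (W - {a, b, c}) = k + 1 - 3"
    using abc W finW by (subst card_Diff_subset) auto
  also have "\<dots> = card {2..k-1}" by simp
  finally obtain g where g: "bij_betw g {2..k-1} (W - {a, b, c})"
    using finite_same_card_bij[of "{2..k-1}" "W - {a,b,c}"] finW by auto
  \<comment> \<open>\<open>g\<close> places the free vertices, which do not occur for
    \<open>k = 2\<close>; the three updates send each special label to the vertex its edge must
    miss.\<close>
  define f where "f = g(1 := b, k := c, k + 1 := a)"
  have fv: "f 1 = b" "f k = c" "f (k+1) = a" using k by (auto simp: f_def)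
  have V: "{1..k+1} = {2..k-1} \<union> {1, k, k+1}" using k by auto
  have fg: "bij_betw f {2..k-1} (W - {a, b, c})"
    using g by (rule bij_betw_cong[THEN iffD1, rotated]) (auto simp: f_def)
  have f3: "bij_betw f {1, k, k+1} {a, b, c}"
    using fv abc by (auto simp: bij_betw_def inj_on_def)
  have "bij_betw f ({2..k-1} \<union> {1, k, k+1}) ((W - {a, b, c}) \<union> {a, b, c})"
    by (rule bij_betw_combine[OF fg f3]) auto
  moreover have "(W - {a, b, c}) \<union> {a, b, c} = W" using abc by auto
  ultimately have f: "bij_betw f {1..k+1} W" using V by simp
  then have inj: "inj_on f {1..k+1}" and im: "f ` {1..k+1} = W" by (auto simp: bij_betw_def)
  have im_diff: "f ` ({1..k+1} - {x}) = W - {f x}" if "x \<in> {1..k+1}" for x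
    using inj_on_image_set_diff[OF inj, of "{1..k+1}" "{x}"] that im by auto
  have eqs: "{1..k} = {1..k+1} - {k+1}" "{2..k+1} = {1..k+1} - {1}"
    "{1..k-1} \<union> {k+1} = {1..k+1} - {k}" using k by auto
  have ims: "f ` {1..k} = W - {a}" "f ` {2..k+1} = W - {b}"
      "f ` ({1..k-1} \<union> {k+1}) = W - {c}"
    unfolding eqs using im_diff[of "k+1"] im_diff[of 1] im_diff[of k] fv k by auto
  have inj_im: "f ` S = f ` S' \<longleftrightarrow> S = S'" if "S \<subseteq> {1..k+1}" "S' \<subseteq> {1..k+1}" for S S'
    using inj_on_image_eq_iff[OF inj that] .
  let ?f = "\<lambda>S. if S = W - {a} \<or> S = W - {b} then Undirected
     else if S = W - {c} then Directed a else No_Edge"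
  let ?G = "\<lparr>verts = W, status = ?f\<rparr>"
  have "pdg_reduce\<^sup>*\<^sup>* H ?G"
    by (rule reduce_to_weaker[OF H W(1)]) (use st in \<open>auto simp: status_weaker_def\<close>)
  moreover have "pdg_iso (pdg_T k) ?G"
    unfolding pdg_iso_def
  proof (intro exI[of _ f] conjI allI impI)
    show "bij_betw f (verts (pdg_T k)) (verts ?G)" using f by (simp add: pdg_T_def)
    fix S assume "S \<subseteq> verts (pdg_T k)"
    then have S: "S \<subseteq> {1..k+1}" by (simp add: pdg_T_def)
    have "f ` S = W - {a} \<longleftrightarrow> S = {1..k}" unfolding ims(1)[symmetric] by (rule inj_im[OF S]) auto
    moreover have "f ` S = W - {b} \<longleftrightarrow> S = {2..k+1}"
      unfolding ims(2)[symmetric] by (rule inj_im[OF S]) auto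
    moreover have "f ` S = W - {c} \<longleftrightarrow> S = {1..k-1} \<union> {k+1}"
      unfolding ims(3)[symmetric] by (rule inj_im[OF S]) auto
    ultimately show "status ?G (f ` S) = map_pdg_status f (status (pdg_T k) S)"
      using fv(3) by (simp add: pdg_T_def)
  qed
  ultimately show ?thesis by (auto simp: pdg_subgraph_def)
qed

section \<open>The lower bound from complete undirected graphs\<close>

lemma reduce_preserves_no_directed:
  assumes "pdg_reduce\<^sup>*\<^sup>* H G" "\<And>S v. status H S \<noteq> Directed v"
  shows "status G S \<noteq> Directed v"
  using assms(1)
proof (induction arbitrary: S v rule: rtranclp_induct)
  case base
  then show ?case using assms(2) by simp
next
  case (step G G')
  from step(2) show ?case using step(3) by (cases rule: pdg_reduce.cases) auto
qed

definition complete_pdg :: "nat \<Rightarrow> 'a set \<Rightarrow> 'a pdg" where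
  "complete_pdg k V =
     \<lparr>verts = V, status = (\<lambda>S. if S \<subseteq> V \<and> card S = k then Undirected else No_Edge)\<rparr>"

text \<open>No reduction creates a direction, whereas \<open>pdg_T k\<close> has a directed
  edge.\<close>

lemma pdg_T_free_complete:
  assumes "k \<ge> 2"
  shows "pdg_free (pdg_T k) (complete_pdg k V)"
  unfolding pdg_free_def
proof
  assume "pdg_subgraph (pdg_T k) (complete_pdg k V)"
  then obtain G f where G: "pdg_reduce\<^sup>*\<^sup>* (complete_pdg k V) G"
    and f: "\<And>S. S \<subseteq> verts (pdg_T k) \<Longrightarrow> status G (f ` S) = map_pdg_status f (status (pdg_T k) S)"
    by (auto simp: pdg_subgraph_def pdg_iso_def)
  let ?S = "{1..k-1} \<union> {k+1}"
  \<comment> \<open>The vertex \<open>k\<close> separates \<open>?S\<close> from both undirected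
    edges, so the definition of \<open>pdg_T\<close> reaches its directed branch.\<close>
  have "k \<in> {1..k}" "k \<in> {2..k+1}" using assms by auto
  moreover have "k \<notin> ?S" using assms by auto
  ultimately have "?S \<noteq> {1..k}" "?S \<noteq> {2..k+1}" by blast+
  then have "status (pdg_T k) ?S = Directed (k+1)"
    by (simp add: pdg_T_def del: Un_insert_right)
  moreover have "?S \<subseteq> verts (pdg_T k)" by (auto simp: pdg_T_def)
  ultimately have "status G (f ` ?S) = Directed (f (k+1))" using f[of ?S] by simp
  moreover have "status G (f ` ?S) \<noteq> Directed (f (k+1))"
    by (rule reduce_preserves_no_directed[OF G]) (simp add: complete_pdg_def)
  ultimately show False by simp
qed

lemma asymp_bound_ge_1:
  assumes k: "k \<ge> 2" and x: "pdg_asymp_bound k (pdg_T k) \<theta> x"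
  shows "1 \<le> x"
proof -
  obtain err :: "nat \<Rightarrow> real" where err: "err \<longlonglongrightarrow> 0"
    and bd: "\<And>H :: nat pdg. is_pdg k H \<Longrightarrow> pdg_free (pdg_T k) H \<Longrightarrow>
           pdg_alpha k H + \<theta> * pdg_beta k H \<le> x + err (card (verts H))"
    using x by (auto simp: pdg_asymp_bound_def)
  have "1 \<le> x + err n" if "n \<ge> k" for n
  proof -
    let ?H = "complete_pdg k {..<n}"
    have "is_pdg k ?H" by (auto simp: is_pdg_def complete_pdg_def split: if_splits)
    then have "pdg_alpha k ?H + \<theta> * pdg_beta k ?H \<le> x + err (card (verts ?H))"
      using bd pdg_T_free_complete[OF k] by blast
    moreover have "undirected_edges ?H = {S. S \<subseteq> {..<n} \<and> card S = k}" "directed_edges ?H = {}"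
      by (auto simp: undirected_edges_def directed_edges_def complete_pdg_def)
    then have "pdg_alpha k ?H = 1" "pdg_beta k ?H = 0"
      using that by (auto simp: pdg_alpha_def pdg_beta_def complete_pdg_def n_subsets)
    ultimately show ?thesis by (simp add: complete_pdg_def)
  qed
  then have "eventually (\<lambda>n. 1 \<le> x + err n) sequentially"
    by (auto simp: eventually_sequentially)
  moreover have "(\<lambda>n. x + err n) \<longlonglongrightarrow> x + 0" by (intro tendsto_intros err)
  ultimately show ?thesis
    by (metis add_0_right tendsto_lowerbound trivial_limit_sequentially)
qed

section \<open>Double counting over subsets and the sum-of-squares inequality\<close>

abbreviation subsets_of_card :: "'a set \<Rightarrow> nat \<Rightarrow> 'a set set" where
  "subsets_of_card V m \<equiv> {S. S \<subseteq> V \<and> card S = m}"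

text \<open>Both sides run over sets with a distinguished element; removing that element and
  inserting it again are inverse bijections.\<close>

lemma sum_subsets_remove:
  fixes F :: "'a set \<Rightarrow> 'a \<Rightarrow> real"
  assumes fin: "finite V"
  shows "(\<Sum>W\<in>subsets_of_card V (Suc m). \<Sum>x\<in>W. F W x) =
    (\<Sum>S\<in>subsets_of_card V m. \<Sum>x\<in>V - S. F (insert x S) x)"
proof -
  have finV: "finite S" if "S \<subseteq> V" for S using fin that finite_subset by auto
  have fs: "finite (subsets_of_card V j)" for j using fin by auto
  have "(\<Sum>W\<in>subsets_of_card V (Suc m). \<Sum>x\<in>W. F W x) =
     (\<Sum>(W, x)\<in>Sigma (subsets_of_card V (Suc m)) (\<lambda>W. W). F W x)"
    using finV by (intro sum.Sigma fs) auto
  also have "\<dots> = (\<Sum>(S, x)\<in>Sigma (subsets_of_card V m) (\<lambda>S. V - S). F (insert x S) x)"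
    by (rule sum.reindex_bij_witness[of _ "\<lambda>(S, x). (insert x S, x)" "\<lambda>(W, x). (W - {x}, x)"])
       (auto simp: insert_absorb finV)
  also have "\<dots> = (\<Sum>S\<in>subsets_of_card V m. \<Sum>x\<in>V - S. F (insert x S) x)"
    using fin by (intro sum.Sigma[symmetric] fs) auto
  finally show ?thesis .
qed

lemma sum_subsets_remove_set:
  fixes F :: "'a set \<Rightarrow> real"
  assumes fin: "finite V"
  shows "(\<Sum>W\<in>subsets_of_card V (Suc m). \<Sum>x\<in>W. F (W - {x})) =
    real (card V - m) * (\<Sum>S\<in>subsets_of_card V m. F S)"
proof -
  have "(\<Sum>W\<in>subsets_of_card V (Suc m). \<Sum>x\<in>W. F (W - {x})) =
     (\<Sum>S\<in>subsets_of_card V m. \<Sum>x\<in>V - S. F (insert x S - {x}))"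
    by (rule sum_subsets_remove[OF fin])
  also have "\<dots> = (\<Sum>S\<in>subsets_of_card V m. real (card V - m) * F S)"
  proof (rule sum.cong[OF refl])
    fix S assume S: "S \<in> subsets_of_card V m"
    then have "(\<Sum>x\<in>V - S. F (insert x S - {x})) = (\<Sum>x\<in>V - S. F S)"
      by (intro sum.cong) auto
    then show "(\<Sum>x\<in>V - S. F (insert x S - {x})) = real (card V - m) * F S"
      using S fin by (auto simp: card_Diff_subset finite_subset)
  qed
  finally show ?thesis by (simp add: sum_distrib_left)
qed

text \<open>The off-diagonal sum is the square of the total minus the diagonal squares. The first
  square is nonnegative, and each diagonal term costs at most \<open>B\<^sup>2\<close>.\<close>

lemma sum_off_diagonal_ge:
  fixes r :: "'a \<Rightarrow> real"
  assumes "finite A" "\<And>x. x \<in> A \<Longrightarrow> \<bar>r x\<bar> \<le> B"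
  shows "(\<Sum>y\<in>A. \<Sum>x\<in>A - {y}. r y * r x) \<ge> - (real (card A) * B\<^sup>2)"
proof -
  have "(\<Sum>y\<in>A. \<Sum>x\<in>A - {y}. r y * r x) = (\<Sum>y\<in>A. (\<Sum>x\<in>A. r y * r x) - r y * r y)"
    using assms(1) by (intro sum.cong refl) (simp add: sum_diff1)
  also have "\<dots> = (\<Sum>y\<in>A. r y)\<^sup>2 - (\<Sum>y\<in>A. (r y)\<^sup>2)"
    by (simp add: sum_subtractf power2_eq_square sum_product)
  finally have eq: "(\<Sum>y\<in>A. \<Sum>x\<in>A - {y}. r y * r x) = (\<Sum>y\<in>A. r y)\<^sup>2 - (\<Sum>y\<in>A. (r y)\<^sup>2)" .
  have "(\<Sum>y\<in>A. (r y)\<^sup>2) \<le> (\<Sum>y\<in>A. B\<^sup>2)"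
  proof (rule sum_mono)
    fix y assume "y \<in> A"
    from power_mono[OF assms(2)[OF this], of 2] show "(r y)\<^sup>2 \<le> B\<^sup>2" by simp
  qed
  then show ?thesis
    unfolding eq sum_constant using zero_le_power2[of "\<Sum>y\<in>A. r y"] by linarith
qed

text \<open>The sets \<open>W - {x}\<close> and \<open>W - {y}\<close> share
  \<open>T = W - {x, y}\<close>. For fixed \<open>T\<close> the summand is \<open>r y * r x\<close>
  with \<open>r z = g (insert z T) z\<close>, so the sum over \<open>x\<close> and \<open>y\<close>
  is an off-diagonal sum, bounded below for each of the \<open>card V choose m\<close> choices of
  \<open>T\<close>.\<close>

lemma sum_square_flags_ge:
  fixes g :: "'a set \<Rightarrow> 'a \<Rightarrow> real"
  assumes fin: "finite V" and B: "\<And>S u. \<bar>g S u\<bar> \<le> B"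
  shows "(\<Sum>W\<in>subsets_of_card V (Suc (Suc m)). \<Sum>x\<in>W. \<Sum>y\<in>W - {x}. g (W - {x}) y * g (W - {y}) x)
    \<ge> - (real (card V choose m) * (real (card V) * B\<^sup>2))"
proof -
  have "(\<Sum>W\<in>subsets_of_card V (Suc (Suc m)). \<Sum>x\<in>W. \<Sum>y\<in>W - {x}. g (W - {x}) y * g (W - {y}) x)
     = (\<Sum>S\<in>subsets_of_card V (Suc m). \<Sum>x\<in>V - S. \<Sum>y\<in>insert x S - {x}.
          g (insert x S - {x}) y * g (insert x S - {y}) x)"
    by (rule sum_subsets_remove[OF fin])
  also have "\<dots> = (\<Sum>S\<in>subsets_of_card V (Suc m). \<Sum>x\<in>V - S. \<Sum>y\<in>S. g S y * g (insert x S - {y}) x)"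
    by (intro sum.cong refl) auto
  \<comment> \<open>With the sum over \<open>y\<close> outermost, the same removal identity applies
    again and splits \<open>S\<close> into \<open>T\<close> and \<open>y\<close>.\<close>
  also have "\<dots> = (\<Sum>S\<in>subsets_of_card V (Suc m). \<Sum>y\<in>S. \<Sum>x\<in>V - S. g S y * g (insert x S - {y}) x)"
    by (intro sum.cong refl sum.swap)
  also have "\<dots> = (\<Sum>T\<in>subsets_of_card V m. \<Sum>y\<in>V - T. \<Sum>x\<in>V - insert y T.
      g (insert y T) y * g (insert x (insert y T) - {y}) x)"
    by (rule sum_subsets_remove[OF fin])
  also have "\<dots> = (\<Sum>T\<in>subsets_of_card V m. \<Sum>y\<in>V - T. \<Sum>x\<in>(V - T) - {y}.
      g (insert y T) y * g (insert x T) x)"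
  proof (intro sum.cong refl)
    fix T y x assume "y \<in> V - T" and x: "x \<in> V - T - {y}"
    then have "insert x (insert y T) - {y} = insert x T" by auto
    then show "g (insert y T) y * g (insert x (insert y T) - {y}) x = g (insert y T) y * g (insert x T) x"
      by simp
  qed auto
  finally have eq: "(\<Sum>W\<in>subsets_of_card V (Suc (Suc m)). \<Sum>x\<in>W. \<Sum>y\<in>W - {x}.
      g (W - {x}) y * g (W - {y}) x) =
    (\<Sum>T\<in>subsets_of_card V m. \<Sum>y\<in>V - T. \<Sum>x\<in>(V - T) - {y}. g (insert y T) y * g (insert x T) x)" .
  have "(\<Sum>T\<in>subsets_of_card V m. - (real (card V) * B\<^sup>2)) \<le>
    (\<Sum>T\<in>subsets_of_card V m. \<Sum>y\<in>V - T. \<Sum>x\<in>(V - T) - {y}. g (insert y T) y * g (insert x T) x)"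
  proof (rule sum_mono)
    fix T
    have "- (real (card V) * B\<^sup>2) \<le> - (real (card (V - T)) * B\<^sup>2)"
      using fin by (auto intro!: mult_right_mono card_mono)
    also have "\<dots> \<le> (\<Sum>y\<in>V - T. \<Sum>x\<in>(V - T) - {y}. g (insert y T) y * g (insert x T) x)"
      using fin B by (intro sum_off_diagonal_ge) auto
    finally show "- (real (card V) * B\<^sup>2) \<le>
      (\<Sum>y\<in>V - T. \<Sum>x\<in>(V - T) - {y}. g (insert y T) y * g (insert x T) x)" .
  qed
  then show ?thesis unfolding eq using fin by (simp add: n_subsets)
qed

section \<open>Edge weights and the passage from a local inequality to a density bound\<close>

definition edge_weight :: "real \<Rightarrow> 'a pdg_status \<Rightarrow> real" where
  "edge_weight \<theta> s = (case s of No_Edge \<Rightarrow> 0 | Undirected \<Rightarrow> 1 | Directed _ \<Rightarrow> \<theta>)"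

lemma alpha_beta_eq_weight:
  assumes H: "is_pdg k H"
  shows "pdg_alpha k H + \<theta> * pdg_beta k H =
    (\<Sum>S\<in>subsets_of_card (verts H) k. edge_weight \<theta> (status H S)) / real (card (verts H) choose k)"
proof -
  let ?E = "subsets_of_card (verts H) k"
  have fin: "finite ?E" using H by (auto simp: is_pdg_def)
  have sub: "undirected_edges H \<subseteq> ?E" "directed_edges H \<subseteq> ?E"
    using H unfolding is_pdg_def undirected_edges_def directed_edges_def
    by (auto 0 4 dest!: spec)
  have "(\<Sum>S\<in>?E. edge_weight \<theta> (status H S)) =
     (\<Sum>S\<in>?E. (if S \<in> undirected_edges H then 1 else 0) + \<theta> * (if S \<in> directed_edges H then 1 else 0))"
    by (intro sum.cong refl)
       (auto simp: edge_weight_def undirected_edges_def directed_edges_def split: pdg_status.splits)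
  also have "\<dots> = real (card (undirected_edges H)) + \<theta> * real (card (directed_edges H))"
    using fin sub by (simp add: sum.distrib sum_distrib_left[symmetric] sum.If_cases Int_absorb1
       del: mult_zero_right)
  finally show ?thesis by (simp add: pdg_alpha_def pdg_beta_def add_divide_distrib)
qed

lemma binomial_step: "(real m + 1) * real (n choose Suc m) = real (n - m) * real (n choose m)"
proof -
  have "Suc m * (n choose Suc m) = (n - m) * (n choose m)"
    by (simp only: binomial_absorption binomial_absorb_comp)
  then have "real (Suc m * (n choose Suc m)) = real ((n - m) * (n choose m))" by (rule arg_cong)
  then show ?thesis by (simp only: of_nat_mult of_nat_Suc) (simp add: add.commute)
qed

text \<open>Sum \<open>loc\<close> over all \<open>(k+1)\<close>-sets. Each \<open>k\<close>-set
  lies in \<open>n - k\<close> of them, and \<open>(k+1) * (n choose (k+1))\<close> equals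
  \<open>(n-k) * (n choose k)\<close>, so the main term of the density is exactly 1. The form is
  bounded below by minus \<open>(n choose (k-1)) * n * B\<^sup>2\<close>, which leaves an error of
  order \<open>1/n\<close>.\<close>

lemma bound_from_local_certificate:
  fixes g :: "'a set \<Rightarrow> 'a \<Rightarrow> real"
  assumes k: "k \<ge> 1" and H: "is_pdg k H" and n: "card (verts H) = n" "n > k"
    and B: "\<And>S u. \<bar>g S u\<bar> \<le> B" and c: "c \<ge> 0"
    and loc: "\<And>W. W \<subseteq> verts H \<Longrightarrow> card W = Suc k \<Longrightarrow>
      (\<Sum>x\<in>W. edge_weight \<theta> (status H (W - {x}))) +
      c / real k * (\<Sum>x\<in>W. \<Sum>y\<in>W - {x}. g (W - {x}) y * g (W - {y}) x) \<le> real k + 1"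
  shows "pdg_alpha k H + \<theta> * pdg_beta k H \<le>
    1 + c * B\<^sup>2 * (real n / ((real n - real k) * (real n - real k + 1)))"
proof -
  let ?V = "verts H"
  let ?Q = "\<lambda>W. \<Sum>x\<in>W. \<Sum>y\<in>W - {x}. g (W - {x}) y * g (W - {y}) x"
  let ?w = "\<lambda>S. edge_weight \<theta> (status H S)"
  obtain m where m: "k = Suc m" using k by (cases k) auto
  have fin: "finite ?V" using H by (simp add: is_pdg_def)
  define N where "N = real (n choose k)"
  define w where "w = (\<Sum>S\<in>subsets_of_card ?V k. ?w S)"
  define d where "d = real n - real k"
  have d: "d > 0" and N: "N > 0" using n by (auto simp: d_def N_def)
  have "(\<Sum>W\<in>subsets_of_card ?V (Suc k). (\<Sum>x\<in>W. ?w (W - {x})) + c / real k * ?Q W)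
     \<le> (\<Sum>W\<in>subsets_of_card ?V (Suc k). real k + 1)"
    by (rule sum_mono) (use loc in auto)
  also have "\<dots> = (real k + 1) * real (n choose Suc k)" using fin n by (simp add: n_subsets)
  also have "\<dots> = d * N"
    using binomial_step[of k n] n by (simp add: d_def N_def of_nat_diff)
  finally have 1: "d * w + c / real k * (\<Sum>W\<in>subsets_of_card ?V (Suc k). ?Q W) \<le> d * N"
    using sum_subsets_remove_set[OF fin, of ?w k] n
    by (simp only: sum.distrib sum_distrib_left[symmetric]) (simp add: d_def w_def of_nat_diff)
  have 2: "(\<Sum>W\<in>subsets_of_card ?V (Suc k). ?Q W) \<ge> - (real (n choose m) * (real n * B\<^sup>2))"
    using sum_square_flags_ge[OF fin B, of m] n m by simp
  have "real (n - m) * real (n choose m) = real k * N"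
    using binomial_step[of m n] m by (simp add: N_def add.commute)
  \<comment> \<open>The factor \<open>k\<close> here cancels the normalization \<open>1 / k\<close>
    of the form in \<open>loc\<close>.\<close>
  then have nm: "real (n choose m) = real k * N / (d + 1)"
    using n m d by (simp add: d_def field_simps of_nat_diff)
  have "d * w \<le> d * N + c / real k * (real (n choose m) * (real n * B\<^sup>2))"
    using 1 mult_left_mono[OF 2, of "c / real k"] c by simp
  also have "\<dots> = d * N + c * N / (d + 1) * (real n * B\<^sup>2)" using k by (simp add: nm)
  finally have "d * w / (d * N) \<le> (d * N + c * N / (d + 1) * (real n * B\<^sup>2)) / (d * N)"
    using d N by (intro divide_right_mono) auto
  then have "w / N \<le> (d * N + c * N / (d + 1) * (real n * B\<^sup>2)) / (d * N)"
    using d by simp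
  also have "\<dots> = 1 + c * B\<^sup>2 * (real n / (d * (d + 1)))"
    using d N by (simp add: divide_simps) (simp add: algebra_simps)
  finally show ?thesis
    unfolding alpha_beta_eq_weight[OF H] using n by (simp add: d_def w_def N_def)
qed

section \<open>Local certificates on a single \<open>(k+1)\<close>-set\<close>

text \<open>In the local certificates \<open>\<sigma> x\<close> stands for the status of \<open>W - {x}\<close>. The value
  \<open>h = 3k/5 - 1\<close> makes the certificate tight when one non-edge is the complement of the head of
  \<open>k\<close> directed edges.\<close>

definition flag_value :: "real \<Rightarrow> 'a pdg_status \<Rightarrow> 'a \<Rightarrow> real" where
  "flag_value h s u = (case s of No_Edge \<Rightarrow> 1 | Undirected \<Rightarrow> 0 | Directed v \<Rightarrow> if v = u then - h else 0)"

lemma flag_value_simps [simp]: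
  "flag_value h No_Edge u = 1" "flag_value h Undirected u = 0"
  "flag_value h (Directed v) u = (if v = u then - h else 0)"
  by (simp_all add: flag_value_def)

lemma edge_weight_simps [simp]:
  "edge_weight \<theta> No_Edge = 0" "edge_weight \<theta> Undirected = 1" "edge_weight \<theta> (Directed v) = \<theta>"
  by (simp_all add: edge_weight_def)

lemma sum_pairs_indicator:
  assumes "finite W" "C \<subseteq> W"
  shows "(\<Sum>x\<in>W. \<Sum>y\<in>W - {x}. of_bool (x \<in> C \<and> y \<in> C)) = real (card C) * (real (card C) - 1)"
proof -
  have fC: "finite C" using assms finite_subset by auto
  have "(\<Sum>x\<in>W. \<Sum>y\<in>W - {x}. of_bool (x \<in> C \<and> y \<in> C)) =
      (\<Sum>x\<in>W. if x \<in> C then real (card C) - 1 else 0)"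
  proof (rule sum.cong[OF refl])
    fix x assume "x \<in> W"
    have "(\<Sum>y\<in>W - {x}. of_bool (x \<in> C \<and> y \<in> C)) = real (card (C - {x}))" if "x \<in> C"
    proof -
      have "(W - {x}) \<inter> {y. y \<in> C} = C - {x}" using assms by auto
      then show ?thesis using that assms by (simp add: of_bool_def sum.If_cases)
    qed
    moreover have "real (card (C - {x})) = real (card C) - 1" if "x \<in> C"
      using that fC card_gt_0_iff[of C] by (auto simp: of_nat_diff)
    ultimately show "(\<Sum>y\<in>W - {x}. of_bool (x \<in> C \<and> y \<in> C)) = (if x \<in> C then real (card C) - 1 else 0)"
      by auto
  qed
  also have "\<dots> = real (card C) * (real (card C) - 1)"
    using assms by (simp add: sum.If_cases Int_absorb1)
  finally show ?thesis .
qed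

lemma sum_heads:
  assumes "finite W" and head: "\<And>x y. x \<in> W \<Longrightarrow> \<sigma> x = Directed y \<Longrightarrow> y \<in> W"
  shows "(\<Sum>x\<in>W. \<Sum>y\<in>W. of_bool (\<sigma> x = Directed y)) = real (card {x \<in> W. \<exists>y. \<sigma> x = Directed y})"
proof -
  have "(\<Sum>x\<in>W. \<Sum>y\<in>W. of_bool (\<sigma> x = Directed y)) = (\<Sum>x\<in>W. if \<exists>y. \<sigma> x = Directed y then 1 else (0::real))"
  proof (rule sum.cong[OF refl])
    fix x assume x: "x \<in> W"
    show "(\<Sum>y\<in>W. of_bool (\<sigma> x = Directed y)) = (if \<exists>y. \<sigma> x = Directed y then 1 else (0::real))"
      using assms(1) head[OF x] by (cases "\<sigma> x") (auto simp: of_bool_def)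
  qed
  also have "\<dots> = real (card {x \<in> W. \<exists>y. \<sigma> x = Directed y})"
    using assms(1) by (simp add: sum.If_cases Int_def)
  finally show ?thesis .
qed

text \<open>With \<open>j\<close> non-edges and \<open>m\<close> directed edges the weight is
  \<open>k + 1 - j + 3/5 * m\<close>. A pair of non-edges contributes 1 to the form in each order,
  and a directed edge paired with the non-edge opposite its head contributes \<open>- h\<close> in
  each order. All other products vanish, so the form equals
  \<open>j * (j - 1) - 2 * h * m\<close>.\<close>

lemma local_certificate_clean:
  fixes \<sigma> :: "'a \<Rightarrow> 'a pdg_status"
  assumes k: "k \<ge> 1" and W: "finite W" "card W = Suc k"
    and head: "\<And>x y. x \<in> W \<Longrightarrow> \<sigma> x = Directed y \<Longrightarrow> y \<in> W \<and> y \<noteq> x \<and> \<sigma> y = No_Edge"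
  shows "(\<Sum>x\<in>W. edge_weight (8/5) (\<sigma> x)) + (1/2) / real k *
    (\<Sum>x\<in>W. \<Sum>y\<in>W - {x}. flag_value (3 * real k / 5 - 1) (\<sigma> x) y * flag_value (3 * real k / 5 - 1) (\<sigma> y) x)
    \<le> real k + 1"
proof -
  define h where "h = 3 * real k / 5 - 1"
  define C where "C = {x \<in> W. \<sigma> x = No_Edge}"
  define D where "D = {x \<in> W. \<exists>y. \<sigma> x = Directed y}"
  define j where "j = real (card C)"
  define m where "m = real (card D)"
  have CD: "C \<subseteq> W" "D \<subseteq> W" "C \<inter> D = {}" by (auto simp: C_def D_def)
  have fin: "finite C" "finite D" using CD W(1) by (auto intro: finite_subset)
  have "(\<Sum>x\<in>W. edge_weight (8/5) (\<sigma> x)) = (\<Sum>x\<in>W. 1 - of_bool (x \<in> C) + 3/5 * of_bool (x \<in> D))"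
    by (intro sum.cong refl) (auto simp: C_def D_def split: pdg_status.splits simp: edge_weight_def)
  also have "\<dots> = real k + 1 - j + 3/5 * m"
  proof -
    have "(\<Sum>x\<in>W. of_bool (x \<in> A)) = real (card A)" if "A \<subseteq> W" for A
      using that W by (simp add: of_bool_def sum.If_cases Int_absorb1)
    from this[OF CD(1)] this[OF CD(2)] W show ?thesis
      unfolding sum.distrib sum_subtractf sum_distrib_left[symmetric] by (simp add: j_def m_def)
  qed
  finally have wt: "(\<Sum>x\<in>W. edge_weight (8/5) (\<sigma> x)) = real k + 1 - j + 3/5 * m" .
  have heads: "(\<Sum>x\<in>W. \<Sum>y\<in>W. of_bool (\<sigma> x = Directed y)) = m"
    unfolding m_def D_def by (rule sum_heads[OF W(1)]) (use head in blast)
  \<comment> \<open>The head of an edge is never the vertex the edge misses, so the diagonal terms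
    are zero.\<close>
  have off: "(\<Sum>y\<in>W - {x}. of_bool (\<sigma> x = Directed y)) = (\<Sum>y\<in>W. of_bool (\<sigma> x = Directed y) :: real)"
    "(\<Sum>y\<in>W - {x}. of_bool (\<sigma> y = Directed x)) = (\<Sum>y\<in>W. of_bool (\<sigma> y = Directed x) :: real)"
    if "x \<in> W" for x
    using head[OF that, of x] that W by (auto intro!: arg_cong[where f = card])
  have "(\<Sum>x\<in>W. \<Sum>y\<in>W - {x}. flag_value h (\<sigma> x) y * flag_value h (\<sigma> y) x) =
    (\<Sum>x\<in>W. \<Sum>y\<in>W - {x}. of_bool (x \<in> C \<and> y \<in> C) - h * of_bool (\<sigma> x = Directed y)
       - h * of_bool (\<sigma> y = Directed x))"
  proof (intro sum.cong refl)
    fix x y assume x: "x \<in> W" and y: "y \<in> W - {x}"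
    show "flag_value h (\<sigma> x) y * flag_value h (\<sigma> y) x = of_bool (x \<in> C \<and> y \<in> C)
       - h * of_bool (\<sigma> x = Directed y) - h * of_bool (\<sigma> y = Directed x)"
      using x y head[of x y] head[of y x] by (cases "\<sigma> x"; cases "\<sigma> y") (auto simp: C_def)
  qed
  also have "\<dots> = (\<Sum>x\<in>W. \<Sum>y\<in>W - {x}. of_bool (x \<in> C \<and> y \<in> C))
     - h * (\<Sum>x\<in>W. \<Sum>y\<in>W. of_bool (\<sigma> x = Directed y)) - h * (\<Sum>x\<in>W. \<Sum>y\<in>W. of_bool (\<sigma> y = Directed x))"
    unfolding sum_subtractf sum_distrib_left[symmetric] by (simp only: off cong: sum.cong)
  also have "(\<Sum>x\<in>W. \<Sum>y\<in>W. of_bool (\<sigma> y = Directed x)) = m"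
    by (subst sum.swap) (rule heads)
  finally have Q: "(\<Sum>x\<in>W. \<Sum>y\<in>W - {x}. flag_value h (\<sigma> x) y * flag_value h (\<sigma> y) x) =
      j * (j - 1) - 2 * h * m"
    using sum_pairs_indicator[OF W(1) CD(1)] heads by (simp add: j_def)
  have "j + m = real (card (C \<union> D))" using fin CD by (simp add: card_Un_disjoint j_def m_def)
  also have "\<dots> \<le> real (card W)" using CD W(1) by (auto intro!: card_mono)
  finally have jm: "j + m \<le> real k + 1" using W by simp
  have m0: "m \<ge> 0" by (simp add: m_def)
  \<comment> \<open>This is the required inequality after inserting \<open>h\<close> and multiplying
    by \<open>2 * k\<close>. Replacing \<open>m\<close> by its bound \<open>k + 1 - j\<close> leaves
    the product \<open>(j - 1) * (2 * k + 2 - j)\<close>; for \<open>j = 0\<close> no head is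
    available, so \<open>m = 0\<close>.\<close>
  have "2 * m + j * (j - 1) \<le> 2 * j * real k"
  proof (cases "C = {}")
    case True
    then have "D = {}" using head unfolding C_def D_def by blast
    then show ?thesis using True by (simp add: j_def m_def)
  next
    case False
    then have "j \<ge> 1" using fin card_gt_0_iff[of C] by (simp add: j_def)
    then have "(j - 1) * (2 * real k + 2 - j) \<ge> 0" using jm m0 k by (intro mult_nonneg_nonneg) auto
    then show ?thesis using jm by (simp add: algebra_simps)
  qed
  then have "(1/2) / real k * (j * (j - 1) - 2 * h * m) \<le> j - 3/5 * m"
    using k by (simp add: h_def field_simps)
  then show ?thesis unfolding wt Q[unfolded h_def] h_def by simp
qed

text \<open>The two edges weigh at most \<open>16/5\<close>. In the form, the \<open>k - 1\<close>
  non-edges contribute \<open>(k - 1) * (k - 2)\<close>, pairs of a non-edge and an edge contribute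
  at most 0, and the two edges contribute at most \<open>h\<^sup>2\<close> in each order.\<close>

lemma local_certificate_two_edges:
  fixes \<sigma> :: "'a \<Rightarrow> 'a pdg_status"
  assumes k: "k \<ge> 3" and W: "finite W" "card W = Suc k"
    and ab: "a \<in> W" "b \<in> W" "a \<noteq> b"
    and none: "\<And>x. x \<in> W - {a, b} \<Longrightarrow> \<sigma> x = No_Edge"
    and edges: "\<sigma> a \<noteq> No_Edge" "\<sigma> b \<noteq> No_Edge"
  shows "(\<Sum>x\<in>W. edge_weight (8/5) (\<sigma> x)) + (1/2) / real k *
    (\<Sum>x\<in>W. \<Sum>y\<in>W - {x}. flag_value (3 * real k / 5 - 1) (\<sigma> x) y * flag_value (3 * real k / 5 - 1) (\<sigma> y) x)
    \<le> real k + 1"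
proof -
  define h where "h = 3 * real k / 5 - 1"
  have h: "h \<ge> 0" using k by (simp add: h_def)
  define C where "C = W - {a, b}"
  have cC: "real (card C) = real k - 1" using W ab k by (simp add: C_def card_Diff_subset of_nat_diff)
  have "(\<Sum>x\<in>W. edge_weight (8/5) (\<sigma> x)) = (\<Sum>x\<in>{a, b}. edge_weight (8/5) (\<sigma> x))"
    using W ab none by (intro sum.mono_neutral_right) auto
  also have "\<dots> \<le> 16/5"
    using ab by (cases "\<sigma> a"; cases "\<sigma> b") auto
  finally have wt: "(\<Sum>x\<in>W. edge_weight (8/5) (\<sigma> x)) \<le> 16/5" .
  have single: "(\<Sum>x\<in>W. \<Sum>y\<in>W - {x}. of_bool (x = u \<and> y = v)) = (1::real)"
    if "u \<in> W" "v \<in> W" "u \<noteq> v" for u v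
  proof -
    have "(\<Sum>x\<in>W. \<Sum>y\<in>W - {x}. of_bool (x = u \<and> y = v)) = (\<Sum>x\<in>W. of_bool (x = u) :: real)"
    proof (intro sum.cong refl)
      fix x assume "x \<in> W"
      show "(\<Sum>y\<in>W - {x}. of_bool (x = u \<and> y = v)) = (of_bool (x = u) :: real)"
        using that W by (cases "x = u") (auto simp: of_bool_def)
    qed
    then show ?thesis using that W by (simp add: of_bool_def)
  qed
  have "(\<Sum>x\<in>W. \<Sum>y\<in>W - {x}. flag_value h (\<sigma> x) y * flag_value h (\<sigma> y) x) \<le>
    (\<Sum>x\<in>W. \<Sum>y\<in>W - {x}. of_bool (x \<in> C \<and> y \<in> C) + h\<^sup>2 * of_bool (x = a \<and> y = b)
       + h\<^sup>2 * of_bool (x = b \<and> y = a))"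
  proof (intro sum_mono)
    fix x y assume x: "x \<in> W" and y: "y \<in> W - {x}"
    have le0: "flag_value h (\<sigma> u) v \<le> 0" if "u \<in> {a, b}" for u v
      using that edges h by (cases "\<sigma> u") auto
    have eq1: "flag_value h (\<sigma> u) v = 1" if "u \<in> C" for u v
      using none[of u] that by (simp add: C_def)
    have sq: "flag_value h s u * flag_value h t v \<le> h\<^sup>2" if "s \<noteq> No_Edge" "t \<noteq> No_Edge" for s t u v
      using that by (cases s; cases t) (auto simp: power2_eq_square)
    consider "x \<in> C" "y \<in> C" | "x \<in> C" "y \<in> {a, b}" | "x \<in> {a, b}" "y \<in> C"
      | "x = a" "y = b" | "x = b" "y = a"
      using x y by (auto simp: C_def)
    then show "flag_value h (\<sigma> x) y * flag_value h (\<sigma> y) x \<le>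
      of_bool (x \<in> C \<and> y \<in> C) + h\<^sup>2 * of_bool (x = a \<and> y = b) + h\<^sup>2 * of_bool (x = b \<and> y = a)"
    proof cases
      case 4
      then show ?thesis using sq[of "\<sigma> a" "\<sigma> b"] edges ab by (auto simp: C_def)
    next
      case 5
      then show ?thesis using sq[of "\<sigma> b" "\<sigma> a"] edges ab by (auto simp: C_def)
    qed (use le0 eq1 in \<open>auto simp: C_def\<close>)
  qed
  also have "\<dots> = (real k - 1) * (real k - 2) + 2 * h\<^sup>2"
  proof -
    have "C \<subseteq> W" by (auto simp: C_def)
    from sum_pairs_indicator[OF W(1) this] single[of a b] single[of b a] ab cC
    show ?thesis by (simp add: sum.distrib sum_distrib_left[symmetric])
  qed
  finally have Q: "(\<Sum>x\<in>W. \<Sum>y\<in>W - {x}. flag_value h (\<sigma> x) y * flag_value h (\<sigma> y) x) \<le>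
      (real k - 1) * (real k - 2) + 2 * h\<^sup>2" .
  have "(1/2) / real k * ((real k - 1) * (real k - 2) + 2 * h\<^sup>2) \<le> real k + 1 - 16/5"
  proof -
    \<comment> \<open>The right side minus the left side of the next inequality is
      \<open>7/25 * k\<^sup>2 + k - 4\<close>, which is positive from \<open>k = 3\<close>
      on.\<close>
    have "real k * real k \<ge> 3 * 3" using k by (intro mult_mono) auto
    then have "(real k - 1) * (real k - 2) + 2 * h\<^sup>2 \<le> 2 * real k * (real k + 1 - 16/5)"
      using k by (simp add: h_def power2_eq_square field_simps)
    then show ?thesis using k by (simp add: field_simps)
  qed
  moreover have "(1/2) / real k * (\<Sum>x\<in>W. \<Sum>y\<in>W - {x}. flag_value h (\<sigma> x) y * flag_value h (\<sigma> y) x)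
     \<le> (1/2) / real k * ((real k - 1) * (real k - 2) + 2 * h\<^sup>2)"
    by (intro mult_left_mono Q) simp
  ultimately show ?thesis using wt unfolding h_def by linarith
qed

text \<open>For \<open>k = 2\<close> the two-edge bound above fails, so the head of a directed edge is ignored.\<close>

definition flag_value2 :: "'a pdg_status \<Rightarrow> real" where
  "flag_value2 s = (case s of No_Edge \<Rightarrow> 1 | Undirected \<Rightarrow> 0 | Directed v \<Rightarrow> - 1)"

text \<open>If a triple has a directed edge, one of its other two pairs is a non-edge: the head lies
  on both the directed edge and one other pair, and either position of the head gives the same
  conclusion. The remaining status patterns form a finite check, with equality for three non-edges
  and for three undirected edges.\<close>

lemma local_certificate_2:
  fixes \<sigma> :: "'a \<Rightarrow> 'a pdg_status"
  assumes W: "card W = 3"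
    and head: "\<And>x y. x \<in> W \<Longrightarrow> \<sigma> x = Directed y \<Longrightarrow> y \<in> W \<and> y \<noteq> x"
    and free: "\<And>a b c. a \<in> W \<Longrightarrow> b \<in> W \<Longrightarrow> c \<in> W \<Longrightarrow> a \<noteq> b \<Longrightarrow> a \<noteq> c \<Longrightarrow> b \<noteq> c \<Longrightarrow>
       \<sigma> c = Directed a \<Longrightarrow> \<sigma> a \<noteq> No_Edge \<Longrightarrow> \<sigma> b = No_Edge"
  shows "(\<Sum>x\<in>W. edge_weight (8/5) (\<sigma> x)) +
    1/2 * (\<Sum>x\<in>W. \<Sum>y\<in>W - {x}. flag_value2 (\<sigma> x) * flag_value2 (\<sigma> y)) \<le> 3"
proof -
  obtain x y z where xyz: "W = {x, y, z}" "x \<noteq> y" "x \<noteq> z" "y \<noteq> z"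
    using W by (auto simp: card_3_iff)
  have diffs: "{x, y, z} - {x} = {y, z}" "{x, y, z} - {y} = {x, z}" "{x, y, z} - {z} = {x, y}"
    using xyz by auto
  have dir: "\<sigma> a = No_Edge \<or> \<sigma> b = No_Edge"
    if "\<sigma> c = Directed v" "{a, b, c} = W" "a \<noteq> b" "a \<noteq> c" "b \<noteq> c" for a b c v
  proof -
    have "v \<in> {a, b}" using head[of c v] that by auto
    then show ?thesis using free[of a b c] free[of b a c] that by auto
  qed
  have d1: "\<sigma> x = No_Edge \<or> \<sigma> y = No_Edge" if "\<sigma> z = Directed v" for v
    using dir[of z v x y] that xyz by auto
  have d2: "\<sigma> x = No_Edge \<or> \<sigma> z = No_Edge" if "\<sigma> y = Directed v" for v
    using dir[of y v x z] that xyz by (auto simp: insert_commute)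
  have d3: "\<sigma> y = No_Edge \<or> \<sigma> z = No_Edge" if "\<sigma> x = Directed v" for v
    using dir[of x v y z] that xyz by (auto simp: insert_commute)
  show ?thesis
    unfolding xyz(1) using xyz(2-) d1 d2 d3
    by (simp add: diffs)
       (cases "\<sigma> x"; cases "\<sigma> y"; cases "\<sigma> z"; simp add: flag_value2_def)
qed

section \<open>The upper bound for graphs without a copy of \<open>pdg_T\<close>\<close>

text \<open>A crude bound for the small graphs, where the certificate gives no useful error
  term.\<close>

lemma weight_le_theta:
  assumes H: "is_pdg k H" and \<theta>: "\<theta> \<ge> 1"
  shows "pdg_alpha k H + \<theta> * pdg_beta k H \<le> \<theta>"
proof -
  let ?E = "subsets_of_card (verts H) k"
  have "edge_weight \<theta> s \<le> \<theta>" for s :: "'a pdg_status" using \<theta> by (cases s) auto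
  then have "(\<Sum>S\<in>?E. edge_weight \<theta> (status H S)) \<le> (\<Sum>S\<in>?E. \<theta>)" by (intro sum_mono)
  also have "\<dots> = real (card (verts H) choose k) * \<theta>"
    using H by (simp add: n_subsets is_pdg_def)
  finally show ?thesis
    unfolding alpha_beta_eq_weight[OF H] using \<theta>
    \<comment> \<open>Without \<open>k\<close>-sets the density is a division by zero, hence
      0.\<close>
    by (cases "(card (verts H) choose k) = 0") (auto simp: field_simps simp del: binomial_eq_0_iff)
qed

text \<open>The certificates have \<open>c = 1\<close>, \<open>B = 1\<close> for
  \<open>k = 2\<close> and \<open>c = 1/2\<close>, \<open>B = k\<close> for
  \<open>k \<ge> 3\<close>; the factor \<open>k\<^sup>2\<close> covers both error terms.\<close>

lemma free_weight_bound:
  assumes k: "k \<ge> 2" and H: "is_pdg k H" and free: "pdg_free (pdg_T k) H"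
    and n: "card (verts H) = n" "n > k"
  shows "pdg_alpha k H + 8/5 * pdg_beta k H \<le>
    1 + (real k)\<^sup>2 * (real n / ((real n - real k) * (real n - real k + 1)))"
proof -
  have finite_W: "finite W" if "W \<subseteq> verts H" for W
    using that H finite_subset by (auto simp: is_pdg_def)
  have head: "y \<in> W \<and> y \<noteq> x" if "status H (W - {x}) = Directed y" for W x y
    using that H by (auto simp: is_pdg_def)
  have T: "status H (W - {b}) = No_Edge"
    if "W \<subseteq> verts H" "card W = Suc k" "a \<in> W" "b \<in> W" "c \<in> W" "a \<noteq> b" "a \<noteq> c" "b \<noteq> c"
      "status H (W - {c}) = Directed a" "status H (W - {a}) \<noteq> No_Edge" for W a b c
    using pdg_T_subgraphI[OF k H] free that unfolding pdg_free_def by (metis Suc_eq_plus1)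
  show ?thesis
  proof (cases "k = 2")
    case True
    have "pdg_alpha k H + 8/5 * pdg_beta k H \<le>
      1 + 1 * 1\<^sup>2 * (real n / ((real n - real k) * (real n - real k + 1)))"
    proof (rule bound_from_local_certificate[where g = "\<lambda>S u. flag_value2 (status H S)"])
      show "\<bar>flag_value2 (status H S)\<bar> \<le> 1" for S
        by (simp add: flag_value2_def split: pdg_status.splits)
      fix W assume W: "W \<subseteq> verts H" "card W = Suc k"
      show "(\<Sum>x\<in>W. edge_weight (8/5) (status H (W - {x}))) + 1 / real k *
        (\<Sum>x\<in>W. \<Sum>y\<in>W - {x}. flag_value2 (status H (W - {x})) * flag_value2 (status H (W - {y})))
        \<le> real k + 1"
      proof -
        have "(\<Sum>x\<in>W. edge_weight (8/5) (status H (W - {x}))) +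
          1/2 * (\<Sum>x\<in>W. \<Sum>y\<in>W - {x}. flag_value2 (status H (W - {x})) * flag_value2 (status H (W - {y})))
          \<le> 3"
        proof (rule local_certificate_2)
          show "card W = 3" using W True by simp
        qed (use head in blast, rule T[OF W])
        then show ?thesis using True by simp
      qed
    qed (use k H n in auto)
    also have "\<dots> \<le> 1 + (real k)\<^sup>2 * (real n / ((real n - real k) * (real n - real k + 1)))"
      using k n by (intro add_left_mono mult_right_mono) auto
    finally show ?thesis .
  next
    case False
    then have k3: "k \<ge> 3" using k by simp
    define h where "h = 3 * real k / 5 - 1"
    have h: "0 \<le> h" "h \<le> real k" using k3 by (auto simp: h_def)
    have "pdg_alpha k H + 8/5 * pdg_beta k H \<le>
      1 + (1/2) * (real k)\<^sup>2 * (real n / ((real n - real k) * (real n - real k + 1)))"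
    proof (rule bound_from_local_certificate[where g = "\<lambda>S u. flag_value h (status H S) u"])
      show "\<bar>flag_value h (status H S) u\<bar> \<le> real k" for S u
        using h k by (simp add: flag_value_def split: pdg_status.splits)
      fix W assume W: "W \<subseteq> verts H" "card W = Suc k"
      let ?\<sigma> = "\<lambda>x. status H (W - {x})"
      show "(\<Sum>x\<in>W. edge_weight (8/5) (?\<sigma> x)) + 1/2 / real k *
        (\<Sum>x\<in>W. \<Sum>y\<in>W - {x}. flag_value h (?\<sigma> x) y * flag_value h (?\<sigma> y) x) \<le> real k + 1"
      \<comment> \<open>If the set opposite the head \<open>y\<close> is also an edge, any third
        edge in \<open>W\<close> would complete a copy of \<open>pdg_T k\<close>, so exactly these
        two edges occur. Otherwise every head is opposite a non-edge.\<close>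
      proof (cases "\<exists>x\<in>W. \<exists>y. ?\<sigma> x = Directed y \<and> ?\<sigma> y \<noteq> No_Edge")
        case True
        then obtain x y where xy: "x \<in> W" "?\<sigma> x = Directed y" "?\<sigma> y \<noteq> No_Edge" by auto
        then show ?thesis unfolding h_def
        proof (intro local_certificate_two_edges[OF k3, of W x y])
          show "?\<sigma> z = No_Edge" if "z \<in> W - {x, y}" for z
            using T[OF W, of y z x] head[OF xy(2)] xy that by blast
        qed (use head[OF xy(2)] finite_W[OF W(1)] W xy in auto)
      next
        case no_such: False
        then show ?thesis unfolding h_def
          using head finite_W[OF W(1)] W k
          by (intro local_certificate_clean) (simp, simp, simp, blast)
      qed
    qed (use k H n in auto)
    also have "\<dots> \<le> 1 + (real k)\<^sup>2 * (real n / ((real n - real k) * (real n - real k + 1)))"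
      using n by (intro add_left_mono mult_right_mono) auto
    finally show ?thesis .
  qed
qed

lemma asymp_bound_1:
  assumes k: "k \<ge> 2"
  shows "pdg_asymp_bound k (pdg_T k) (8/5) 1"
proof -
  \<comment> \<open>For \<open>n \<le> 2 * k\<close> the crude bound \<open>8/5\<close> is below
    \<open>1 + 1\<close>. Beyond that \<open>n - k \<ge> n / 2\<close>, which turns the error into
    at most \<open>4 * k\<^sup>2 / n\<close>.\<close>
  define err :: "nat \<Rightarrow> real" where
    "err = (\<lambda>n. if n \<le> 2 * k then 1 else 4 * (real k)\<^sup>2 / real n)"
  have "(\<lambda>n. 4 * (real k)\<^sup>2 / real n) \<longlonglongrightarrow> 0" by (rule lim_const_over_n)
  moreover have "eventually (\<lambda>n. 4 * (real k)\<^sup>2 / real n = err n) sequentially"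
    using eventually_gt_at_top[of "2 * k"] by eventually_elim (simp add: err_def)
  ultimately have "err \<longlonglongrightarrow> 0" by (rule Lim_transform_eventually)
  moreover have "pdg_alpha k H + 8/5 * pdg_beta k H \<le> 1 + err (card (verts H))"
    if H: "is_pdg k H" "pdg_free (pdg_T k) H" for H :: "nat pdg"
  proof (cases "card (verts H) \<le> 2 * k")
    case True
    then show ?thesis using weight_le_theta[OF H(1), of "8/5"] by (simp add: err_def)
  next
    case False
    define n where "n = card (verts H)"
    have n: "n > 2 * k" using False by (simp add: n_def)
    then have d: "real n - real k \<ge> real n / 2" by linarith
    have "(real n / 2) * (real n / 2) \<le> (real n - real k) * (real n - real k + 1)"
      using d by (intro mult_mono) auto
    then have "real n / ((real n - real k) * (real n - real k + 1)) \<le> real n / ((real n / 2) * (real n / 2))"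
      using n by (intro divide_left_mono mult_pos_pos) auto
    also have "\<dots> = 4 / real n" using n by (simp add: field_simps)
    finally have "(real k)\<^sup>2 * (real n / ((real n - real k) * (real n - real k + 1))) \<le> (real k)\<^sup>2 * (4 / real n)"
      by (intro mult_left_mono) auto
    then show ?thesis
      using free_weight_bound[OF k H, of n] n by (simp add: err_def n_def mult.commute)
  qed
  ultimately show ?thesis unfolding pdg_asymp_bound_def by blast
qed

section \<open>The numerical comparison for \<open>8/5\<close> and the value of
  \<open>pdg_pi\<close>\<close>

lemma log_2_3_less: "log 2 3 < (8/5 :: real)"
proof -
  have "5 * log 2 (3::real) = log 2 (3 ^ 5)" by (subst log_nat_power) auto
  also have "\<dots> < log 2 (2 ^ 8)" by (subst log_less_cancel_iff) auto
  also have "\<dots> = 8" by (subst log_nat_power) auto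
  finally show ?thesis by simp
qed

theorem theorem1p15:
  fixes k :: nat
  assumes "k \<ge> 2"
  shows "\<exists>\<theta>::real. \<theta> > log 2 3 \<and> pdg_pi k (pdg_T k) \<theta> = 1"
proof (intro exI[of _ "8/5"] conjI)
  show "log 2 3 < (8/5 :: real)" by (rule log_2_3_less)
  show "pdg_pi k (pdg_T k) (8/5) = 1"
    unfolding pdg_pi_def
    using asymp_bound_1[OF assms] asymp_bound_ge_1[OF assms] by (rule Least_equality)
qed

end
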